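(* For every real number $\beta > 1$ and every real number $x \in [0,1)$ whose $\beta$-expansion is not purely periodic, we have $\widehat{r}_\beta(x) \le 1$.
   Context: For a real number $\beta > 1$, the $\beta$-transformation $T_\beta$ on $[0,1)$ is defined by $T_\beta(x) = \beta x \bmod 1$ (that is, $T_\beta(x) = \beta x - \lfloor \beta x \rfloor$), and $T_\beta^n$ denotes its $n$-th iterate. The $\beta$-expansion of $x \in [0,1)$ is the sequence $(\varepsilon_n(x,\beta))_{n \ge 1}$ of integers given by $\varepsilon_n(x,\beta) = \lfloor \beta T_\beta^{n-1}(x) \rfloor$ for $n \ge 1$, so that $x = \sum_{n \ge 1} \varepsilon_n(x,\beta) \beta^{-n}$. It is purely periodic if there is an integer $p \ge 1$ with $\varepsilon_{n+p}(x,\beta) = \varepsilon_n(x,\beta)$ for all $n \ge 1$. For $x \in [0,1)$, set $$\widehat{r}_\beta(x) := \sup\{ \widehat{r} \ge 0 : \text{for every sufficiently large integer } N, \text{ there exists an integer } n \text{ such that } 1 \le n \le N \text{ and } |T_\beta^n x - x| < (\beta^N)^{-\widehat{r}}\},$$ which takes values in $[0,+\infty]$. *)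

theory Defs
  imports "HOL-Analysis.Analysis"
begin

definition beta_map :: "real \<Rightarrow> real \<Rightarrow> real" where
  "beta_map \<beta> x = \<beta> * x - of_int \<lfloor>\<beta> * x\<rfloor>"

text \<open>Digits are indexed from 1; the value at index 0 carries no meaning.\<close>

definition beta_digit :: "nat \<Rightarrow> real \<Rightarrow> real \<Rightarrow> int" where
  "beta_digit n x \<beta> = \<lfloor>\<beta> * (beta_map \<beta> ^^ (n - 1)) x\<rfloor>"

definition purely_periodic_expansion :: "real \<Rightarrow> real \<Rightarrow> bool" where
  "purely_periodic_expansion \<beta> x \<longleftrightarrow>
     (\<exists>p\<ge>1. \<forall>n\<ge>1. beta_digit (n + p) x \<beta> = beta_digit n x \<beta>)"

text \<open>The supremum is taken in \<^typ>\<open>ereal\<close> over finite nonnegative exponents, so it may be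
  infinite. For \<open>0 \<le> x < 1 < \<beta>\<close> the exponent 0 always qualifies, so the supremum of the empty
  set does not arise.\<close>

definition uniform_recurrence_exponent :: "real \<Rightarrow> real \<Rightarrow> ereal" where
  "uniform_recurrence_exponent \<beta> x =
     Sup (ereal ` {r. 0 \<le> r \<and>
       (\<forall>\<^sub>F N in sequentially. \<exists>n. 1 \<le> n \<and> n \<le> N \<and>
          \<bar>(beta_map \<beta> ^^ n) x - x\<bar> < (\<beta> ^ N) powr (- r))})"

end

theory Submission
  imports Defs
begin

text \<open>
  Write \<open>e\<^sub>n = T\<^sup>n x - x\<close>, which never vanishes for \<open>n \<ge> 1\<close> since the expansion is not purely
  periodic. If the exponent exceeded 1, there would be \<open>n < m\<close> with \<open>\<bar>e\<^sub>m\<bar> < \<bar>e\<^sub>n\<bar>\<close> and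
  \<open>\<beta>\<^sup>m \<bar>e\<^sub>n\<bar>\<close> as small as we like. If \<open>T\<^sup>m x\<close> and \<open>x\<close> share their first \<open>n\<close> digits and \<open>T\<^sup>n x\<close>
  and \<open>x\<close> share their first \<open>m\<close> digits, computing \<open>T\<^sup>n\<^sup>+\<^sup>m x\<close> in two ways gives
  \<open>(\<beta>\<^sup>m - 1) e\<^sub>n = (\<beta>\<^sup>n - 1) e\<^sub>m\<close>, which is absurd. The remaining cases use that
  when \<open>y < z\<close> have different digits, the orbit of the larger point \<open>z\<close> after the first disagreement
  stays below \<open>\<beta>\<^sup>i (z - y)\<close>, so \<open>z\<close> has zero digits there for as long as this bound is small.
\<close>

section \<open>Comparing orbits through their digits\<close>

definition digits_agree :: "real \<Rightarrow> nat \<Rightarrow> real \<Rightarrow> real \<Rightarrow> bool" where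
  "digits_agree \<beta> i y z \<longleftrightarrow>
     (\<forall>t<i. \<lfloor>\<beta> * (beta_map \<beta> ^^ t) y\<rfloor> = \<lfloor>\<beta> * (beta_map \<beta> ^^ t) z\<rfloor>)"

lemma digits_agree_sym: "digits_agree \<beta> i y z \<longleftrightarrow> digits_agree \<beta> i z y"
  unfolding digits_agree_def by metis

lemma beta_map_bounds: "0 \<le> beta_map \<beta> y" "beta_map \<beta> y < 1"
  unfolding beta_map_def by linarith+

lemma beta_map_funpow_Suc:
  "(beta_map \<beta> ^^ Suc i) y =
     \<beta> * (beta_map \<beta> ^^ i) y - of_int \<lfloor>\<beta> * (beta_map \<beta> ^^ i) y\<rfloor>"
  by (simp only: funpow.simps o_apply) (simp only: beta_map_def)

lemma beta_map_funpow_bounds: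
  assumes "y \<in> {0..<1}"
  shows "(beta_map \<beta> ^^ i) y \<in> {0..<1}"
  using assms beta_map_bounds by (cases i) auto

lemma beta_map_funpow_le:
  assumes "\<beta> > 1" "y \<in> {0..<1}"
  shows "(beta_map \<beta> ^^ i) y \<le> \<beta> ^ i * y"
proof (induction i)
  case (Suc i)
  let ?w = "(beta_map \<beta> ^^ i) y"
  have "0 \<le> \<beta> * ?w"
    using beta_map_funpow_bounds[OF assms(2)] assms(1) by auto
  hence "beta_map \<beta> ?w \<le> \<beta> * ?w"
    unfolding beta_map_def by simp
  also have "\<dots> \<le> \<beta> * (\<beta> ^ i * y)"
    using Suc assms(1) by (intro mult_left_mono) auto
  finally show ?case by (simp add: mult.assoc)
qed simp

text \<open>On a block of common digits both orbits undergo the same affine maps of slope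
  \<open>\<beta>\<close>.\<close>

lemma digits_agree_diff:
  assumes "digits_agree \<beta> i y z"
  shows "(beta_map \<beta> ^^ i) z - (beta_map \<beta> ^^ i) y = \<beta> ^ i * (z - y)"
  using assms
proof (induction i)
  case (Suc i)
  hence IH: "(beta_map \<beta> ^^ i) z - (beta_map \<beta> ^^ i) y = \<beta> ^ i * (z - y)"
    by (simp add: digits_agree_def)
  have "(beta_map \<beta> ^^ Suc i) z - (beta_map \<beta> ^^ Suc i) y =
      \<beta> * ((beta_map \<beta> ^^ i) z - (beta_map \<beta> ^^ i) y)"
    using Suc.prems unfolding digits_agree_def beta_map_funpow_Suc
    by (simp add: right_diff_distrib)
  thus ?case by (simp only: IH power_Suc mult.assoc)
qed simp

lemma first_disagreement:
  assumes "\<not> digits_agree \<beta> i y z"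
  obtains t where "t < i" "digits_agree \<beta> t y z"
    "\<lfloor>\<beta> * (beta_map \<beta> ^^ t) y\<rfloor> \<noteq> \<lfloor>\<beta> * (beta_map \<beta> ^^ t) z\<rfloor>"
proof -
  let ?P = "\<lambda>t. t < i \<and> \<lfloor>\<beta> * (beta_map \<beta> ^^ t) y\<rfloor> \<noteq> \<lfloor>\<beta> * (beta_map \<beta> ^^ t) z\<rfloor>"
  obtain s where "?P s"
    using assms unfolding digits_agree_def by blast
  hence "?P (LEAST t. ?P t)" "\<And>t. t < (LEAST t. ?P t) \<Longrightarrow> \<not> ?P t"
    by (rule LeastI) (rule not_less_Least)
  thus ?thesis
    using that[of "LEAST t. ?P t"] unfolding digits_agree_def by (meson order.strict_trans)
qed

lemma digit_less_at_disagreement: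
  assumes "\<beta> > 1" "y < z" "digits_agree \<beta> t y z"
    and "\<lfloor>\<beta> * (beta_map \<beta> ^^ t) y\<rfloor> \<noteq> \<lfloor>\<beta> * (beta_map \<beta> ^^ t) z\<rfloor>"
  shows "\<lfloor>\<beta> * (beta_map \<beta> ^^ t) y\<rfloor> < \<lfloor>\<beta> * (beta_map \<beta> ^^ t) z\<rfloor>"
proof -
  have "(beta_map \<beta> ^^ t) z - (beta_map \<beta> ^^ t) y > 0"
    using digits_agree_diff[OF assms(3)] assms(1,2) by simp
  hence "\<beta> * (beta_map \<beta> ^^ t) y \<le> \<beta> * (beta_map \<beta> ^^ t) z"
    using assms(1) by simp
  thus ?thesis
    using assms(4) floor_mono by (simp add: order_less_le)
qed

text \<open>At the first disagreement the integer part of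
  \<open>\<beta> * (beta_map \<beta> ^^ t) z\<close> lies strictly above the image of the lower
  orbit, so the fractional part left to \<open>z\<close> is less than the gap between the two
  images. Later steps multiply it by at most \<open>\<beta>\<close>.\<close>

lemma upper_orbit_after_disagreement:
  assumes "\<beta> > 1" "y < z" "digits_agree \<beta> t y z"
    and "\<lfloor>\<beta> * (beta_map \<beta> ^^ t) y\<rfloor> \<noteq> \<lfloor>\<beta> * (beta_map \<beta> ^^ t) z\<rfloor>"
    and "t < i"
  shows "(beta_map \<beta> ^^ i) z < \<beta> ^ i * (z - y)"
proof -
  let ?y = "(beta_map \<beta> ^^ t) y" and ?z = "(beta_map \<beta> ^^ t) z"
  define w where "w = (beta_map \<beta> ^^ Suc t) z"
  have "\<beta> * ?y < of_int \<lfloor>\<beta> * ?z\<rfloor>"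
    using digit_less_at_disagreement[OF assms(1-4)] by linarith
  hence "w < \<beta> * ?z - \<beta> * ?y"
    unfolding w_def beta_map_funpow_Suc by linarith
  also have "\<dots> = \<beta> ^ Suc t * (z - y)"
    using digits_agree_diff[OF assms(3)] by (simp add: mult.assoc flip: right_diff_distrib)
  finally have w: "w < \<beta> ^ Suc t * (z - y)" .
  obtain s where i: "i = s + Suc t"
    using assms(5) less_natE by (metis add.commute add_Suc_right)
  have "(beta_map \<beta> ^^ i) z = (beta_map \<beta> ^^ s) w"
    unfolding i w_def funpow_add by simp
  also have "\<dots> \<le> \<beta> ^ s * w"
    using beta_map_funpow_le[OF assms(1)] beta_map_bounds by (simp add: w_def)
  also have "\<dots> < \<beta> ^ s * (\<beta> ^ Suc t * (z - y))"
    using w assms(1) by simp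
  finally show ?thesis
    by (simp add: i power_add mult_ac)
qed

text \<open>The orbit point of index \<open>n + m\<close> is read both as the \<open>n\<close>-th
  iterate of \<open>X m\<close> and as the \<open>m\<close>-th iterate of \<open>X n\<close>. Its
  size relative to \<open>\<eta>\<close> tells whether the digits involved agree with those of
  \<open>x\<close>, so both readings must give the same answer.\<close>

lemma no_close_record_returns:
  fixes \<beta> x \<eta> :: real and n m :: nat
  defines "e \<equiv> \<lambda>i. (beta_map \<beta> ^^ i) x - x"
  assumes \<beta>: "\<beta> > 1" and x: "x \<in> {0..<1}" and "n < m"
    and rec: "\<bar>e m\<bar> < \<bar>e n\<bar>"
    and close: "\<beta> ^ m * \<bar>e n\<bar> < \<eta>" and \<eta>: "3 * \<eta> \<le> x" "\<eta> \<le> 1"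
  shows False
proof -
  define X where "X i = (beta_map \<beta> ^^ i) x" for i
  have X: "X i = x + e i" for i
    by (simp add: X_def e_def)
  have diff: "X i - x = e i" for i
    by (simp add: X)
  have iter: "(beta_map \<beta> ^^ i) (X j) = X (i + j)" for i j
    by (simp add: X_def funpow_add)
  have bound: "\<beta> ^ i * \<bar>e j\<bar> < \<eta>" if "i \<le> m" "\<bar>e j\<bar> \<le> \<bar>e n\<bar>" for i j
  proof -
    have "\<beta> ^ i * \<bar>e j\<bar> \<le> \<beta> ^ m * \<bar>e n\<bar>"
      using that \<beta> by (intro mult_mono power_increasing) auto
    thus ?thesis using close by simp
  qed
  have en: "\<bar>e n\<bar> < \<eta>" and em: "\<bar>e m\<bar> < \<eta>"
    using bound[of 0 n] bound[of 0 m] rec by auto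
  have bnm: "\<beta> ^ n * \<bar>e m\<bar> < \<eta>" and bmn: "\<beta> ^ m * \<bar>e n\<bar> < \<eta>"
    using bound[of n m] bound[of m n] rec \<open>n < m\<close> by auto
  \<comment> \<open>A return from below cannot change digits: \<open>X i\<close> would then be small, but it is close to \<open>x\<close>.\<close>
  have above: "x < X j"
    if dis: "\<not> digits_agree \<beta> i x (X j)" "\<beta> ^ i * \<bar>e j\<bar> < \<eta>" "\<bar>e i\<bar> < \<eta>" for i j
  proof (rule ccontr)
    assume "\<not> x < X j"
    moreover have "x \<noteq> X j"
      using dis(1) unfolding digits_agree_def by auto
    ultimately have less: "X j < x" by simp
    obtain t where "t < i" "digits_agree \<beta> t (X j) x"
      "\<lfloor>\<beta> * (beta_map \<beta> ^^ t) (X j)\<rfloor> \<noteq> \<lfloor>\<beta> * (beta_map \<beta> ^^ t) x\<rfloor>"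
      using first_disagreement dis(1) digits_agree_sym by metis
    from upper_orbit_after_disagreement[OF \<beta> less this(2,3,1)]
    have "X i < \<beta> ^ i * (x - X j)"
      unfolding X_def[of i] .
    also have "x - X j = \<bar>e j\<bar>"
      using less X[of j] by simp
    finally have "X i < \<beta> ^ i * \<bar>e j\<bar>" .
    thus False
      using dis(2,3) \<eta> X[of i] by linarith
  qed
  \<comment> \<open>By \<open>above\<close>, \<open>X j\<close> is the larger point, hence the one
    whose orbit drops near 0.\<close>
  have small: "X (i + j) < \<eta>"
    if dis: "\<not> digits_agree \<beta> i x (X j)" "\<beta> ^ i * \<bar>e j\<bar> < \<eta>" "\<bar>e i\<bar> < \<eta>" for i j
  proof -
    obtain t where "t < i" "digits_agree \<beta> t x (X j)"
      "\<lfloor>\<beta> * (beta_map \<beta> ^^ t) x\<rfloor> \<noteq> \<lfloor>\<beta> * (beta_map \<beta> ^^ t) (X j)\<rfloor>"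
      using first_disagreement dis(1) by metis
    from upper_orbit_after_disagreement[OF \<beta> above[OF dis] this(2,3,1)]
    have "X (i + j) < \<beta> ^ i * e j"
      unfolding iter diff .
    also have "\<dots> \<le> \<beta> ^ i * \<bar>e j\<bar>"
      using \<beta> by simp
    finally show ?thesis using dis(2) by simp
  qed
  have agree_eq: "X (i + j) = x + e i + \<beta> ^ i * e j" if "digits_agree \<beta> i x (X j)" for i j
    using digits_agree_diff[OF that] X[of i] unfolding iter diff X_def[symmetric] by linarith
  \<comment> \<open>The factor 3 in \<open>3 * \<eta> \<le> x\<close> is spent here: two errors
    below \<open>\<eta>\<close> are subtracted from \<open>x\<close> and \<open>\<eta>\<close> must
    remain.\<close>
  have large: "X (i + j) \<ge> \<eta>"
    if "digits_agree \<beta> i x (X j)" "\<beta> ^ i * \<bar>e j\<bar> < \<eta>" "\<bar>e i\<bar> < \<eta>" for i j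
  proof -
    have "\<bar>\<beta> ^ i * e j\<bar> < \<eta>"
      using that(2) \<beta> by (simp add: abs_mult)
    thus ?thesis
      using agree_eq[OF that(1)] that(3) \<eta> by linarith
  qed
  \<comment> \<open>In a mixed case \<open>small\<close> and \<open>large\<close> would contradict
    each other at the index \<open>n + m\<close>.\<close>
  consider (both) "digits_agree \<beta> n x (X m)" "digits_agree \<beta> m x (X n)"
    | (none) "\<not> digits_agree \<beta> n x (X m)" "\<not> digits_agree \<beta> m x (X n)"
    using small[of n m] large[of n m] small[of m n] large[of m n] en em bnm bmn
    by (smt (verit) add.commute)
  thus False
  proof cases
    case both
    have "e n * (\<beta> ^ m - 1) = e m * (\<beta> ^ n - 1)"
      using agree_eq[OF both(1)] agree_eq[OF both(2)] by (simp add: add.commute algebra_simps)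
    hence "\<bar>e n\<bar> * (\<beta> ^ m - 1) = \<bar>e m\<bar> * (\<beta> ^ n - 1)"
      using \<beta> by (metis abs_mult abs_of_nonneg diff_ge_0_iff_ge less_imp_le one_le_power)
    moreover have "\<bar>e m\<bar> * (\<beta> ^ n - 1) \<le> \<bar>e m\<bar> * (\<beta> ^ m - 1)"
      using \<beta> \<open>n < m\<close> by (intro mult_left_mono) auto
    moreover have "\<bar>e m\<bar> * (\<beta> ^ m - 1) < \<bar>e n\<bar> * (\<beta> ^ m - 1)"
      using rec \<beta> \<open>n < m\<close> by (intro mult_strict_right_mono) (auto intro!: one_less_power)
    ultimately show False by simp
  next
    case none
    have m_pos: "x < X m" and n_pos: "x < X n"
      using above none bnm bmn en em by blast+
    hence "X m < X n"
      using rec X by (metis abs_of_pos add_less_cancel_left less_add_same_cancel1)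
    obtain s where s: "s < n" "digits_agree \<beta> s x (X m)"
      "\<lfloor>\<beta> * (beta_map \<beta> ^^ s) x\<rfloor> \<noteq> \<lfloor>\<beta> * (beta_map \<beta> ^^ s) (X m)\<rfloor>"
      using first_disagreement none(1) by metis
    obtain t where t: "t < m" "digits_agree \<beta> t x (X n)"
      "\<lfloor>\<beta> * (beta_map \<beta> ^^ t) x\<rfloor> \<noteq> \<lfloor>\<beta> * (beta_map \<beta> ^^ t) (X n)\<rfloor>"
      using first_disagreement none(2) by metis
    have dig: "\<lfloor>\<beta> * X s\<rfloor> < \<lfloor>\<beta> * X (s + m)\<rfloor>"
      using digit_less_at_disagreement[OF \<beta> m_pos s(2,3)] unfolding iter X_def[symmetric] .
    \<comment> \<open>Otherwise \<open>X n\<close> has the same digit as \<open>x\<close> at index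
      \<open>s\<close>. As \<open>X m < X n\<close> and both share the first \<open>s\<close> digits
      of \<open>x\<close>, the digit of \<open>X m\<close> there could not exceed that of
      \<open>x\<close>, against \<open>dig\<close>.\<close>
    have "t \<le> s"
    proof (rule ccontr)
      assume "\<not> t \<le> s"
      hence st: "s < t" by simp
      hence "digits_agree \<beta> s x (X n)"
        using t(2) by (simp add: digits_agree_def)
      from digits_agree_diff[OF this] digits_agree_diff[OF s(2)]
      have "X (s + n) - X (s + m) = \<beta> ^ s * (X n - X m)"
        unfolding iter by (simp add: algebra_simps)
      hence "X (s + m) \<le> X (s + n)"
        using \<open>X m < X n\<close> \<beta> by (smt (verit) mult_pos_pos zero_less_power)
      hence "\<lfloor>\<beta> * X (s + m)\<rfloor> \<le> \<lfloor>\<beta> * X (s + n)\<rfloor>"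
        using \<beta> by (intro floor_mono mult_left_mono) auto
      also have "\<dots> = \<lfloor>\<beta> * X s\<rfloor>"
        using t(2) st unfolding digits_agree_def by (metis X_def iter)
      finally show False using dig by simp
    qed
    \<comment> \<open>The positive digit of \<open>X m\<close> at \<open>s\<close> falls into the block of zero digits of \<open>X n\<close> after \<open>t\<close>.\<close>
    define i where "i = m - n + s"
    \<comment> \<open>Since \<open>s < n\<close>, the exponent \<open>Suc i\<close> stays within the
      range of \<open>bound\<close>.\<close>
    have "t < i" "Suc i \<le> m" "s + m = i + n"
      using \<open>t \<le> s\<close> s(1) \<open>n < m\<close> by (auto simp: i_def)
    have "X (i + n) < \<beta> ^ i * e n"
      using upper_orbit_after_disagreement[OF \<beta> n_pos t(2,3) \<open>t < i\<close>] unfolding iter diff .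
    hence "\<beta> * X (i + n) < \<beta> ^ Suc i * \<bar>e n\<bar>"
      using \<beta> by (smt (verit) mult_less_cancel_left_pos mult.assoc power_Suc zero_less_power
          mult_left_mono)
    also have "\<dots> < 1"
      using bound[OF \<open>Suc i \<le> m\<close>, of n] \<eta> by simp
    finally have "\<lfloor>\<beta> * X (s + m)\<rfloor> \<le> 0"
      unfolding \<open>s + m = i + n\<close> by linarith
    moreover have "0 \<le> \<lfloor>\<beta> * X s\<rfloor>"
      using beta_map_funpow_bounds[OF x] \<beta> by (simp add: X_def)
    ultimately show False using dig by linarith
  qed
qed

section \<open>From uniform recurrence to record returns\<close>

lemma purely_periodic_if_return:
  assumes "p \<ge> 1" "(beta_map \<beta> ^^ p) x = x"
  shows "purely_periodic_expansion \<beta> x"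
proof -
  have "(beta_map \<beta> ^^ (n + p - 1)) x = (beta_map \<beta> ^^ (n - 1)) x" if "n \<ge> 1" for n
  proof -
    have "n + p - 1 = (n - 1) + p" using that by simp
    thus ?thesis using assms(2) by (simp add: funpow_add)
  qed
  thus ?thesis
    using assms(1) unfolding purely_periodic_expansion_def beta_digit_def by auto
qed

text \<open>Let \<open>n\<close> be the best return up to a large \<open>N\<close> and
  \<open>m\<close> the first better one. The recurrence condition at \<open>m - 1\<close> still has
  only returns no better than \<open>n\<close> at its disposal, so it bounds
  \<open>\<bar>e n\<bar>\<close> itself; for \<open>r > 1\<close> this beats the factor
  \<open>\<beta> ^ m\<close>.\<close>

lemma exponent_le_one:
  fixes \<beta> x r :: real
  defines "e \<equiv> \<lambda>i. (beta_map \<beta> ^^ i) x - x"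
  assumes \<beta>: "\<beta> > 1" and x: "x \<in> {0..<1}" and np: "\<not> purely_periodic_expansion \<beta> x"
    and ev: "\<forall>\<^sub>F N in sequentially. \<exists>n. 1 \<le> n \<and> n \<le> N \<and> \<bar>e n\<bar> < (\<beta> ^ N) powr (- r)"
  shows "r \<le> 1"
proof (rule ccontr)
  assume "\<not> r \<le> 1"
  hence r: "r > 1" by simp
  have e0: "e i \<noteq> 0" if "i \<ge> 1" for i
    using purely_periodic_if_return[OF that] np by (auto simp: e_def)
  \<comment> \<open>The fixed point 0 would return exactly; this makes \<open>\<eta>\<close>
    positive.\<close>
  have "x \<noteq> 0"
    using e0[of 1] by (auto simp: e_def beta_map_def)
  define \<eta> where "\<eta> = x / 3"
  have \<eta>: "\<eta> > 0" "3 * \<eta> \<le> x" "\<eta> \<le> 1"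
    using x \<open>x \<noteq> 0\<close> by (auto simp: \<eta>_def)
  have pw: "(\<beta> ^ N) powr (- r) = \<beta> powr (- r * real N)" for N
    using \<beta> by (simp add: powr_powr mult.commute flip: powr_realpow)
  have lim: "(\<lambda>N. \<beta> powr (a + b * real N)) \<longlonglongrightarrow> 0" if "b < 0" for a b
  proof -
    have "(\<lambda>N. \<beta> powr a * (\<beta> powr b) ^ N) \<longlonglongrightarrow> \<beta> powr a * 0"
      using that \<beta> by (intro tendsto_mult_left LIMSEQ_realpow_zero) (auto simp: powr_less_one)
    thus ?thesis
      using \<beta> by (simp add: powr_add powr_powr flip: powr_realpow)
  qed
  obtain N0 where N0: "\<And>N. N \<ge> N0 \<Longrightarrow> \<exists>n. 1 \<le> n \<and> n \<le> N \<and> \<bar>e n\<bar> < \<beta> powr (- r * real N)"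
    using ev unfolding eventually_sequentially pw by blast
  have "\<forall>\<^sub>F N in sequentially. \<beta> powr (1 + (1 - r) * real N) < \<eta>"
    using order_tendstoD(2)[OF lim \<eta>(1)] r by simp
  then obtain N1 where N1: "\<And>N. N \<ge> N1 \<Longrightarrow> \<beta> powr (1 + (1 - r) * real N) < \<eta>"
    unfolding eventually_sequentially by blast
  \<comment> \<open>The 1 makes \<open>{1..N}\<close> nonempty, \<open>N0\<close> starts the
    recurrence condition, and \<open>N1\<close> brings the final bound below
    \<open>\<eta>\<close>.\<close>
  define N where "N = max 1 (max N0 N1)"
  obtain n where n: "n \<in> {1..N}" "\<And>i. i \<in> {1..N} \<Longrightarrow> \<bar>e n\<bar> \<le> \<bar>e i\<bar>"
    using ex_min_if_finite[of "(\<lambda>i. \<bar>e i\<bar>) ` {1..N}"]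
    by (force simp: N_def not_less)
  \<comment> \<open>As \<open>e n\<close> is nonzero, the recurrence condition at a large
    \<open>M\<close> forces a strictly better return, so \<open>m\<close> exists.\<close>
  have "\<forall>\<^sub>F M in sequentially. \<beta> powr (0 + (- r) * real M) < \<bar>e n\<bar>"
    using r e0 n(1) by (intro order_tendstoD(2)[OF lim]) auto
  then obtain N2 where "\<And>M. M \<ge> N2 \<Longrightarrow> \<beta> powr (- r * real M) < \<bar>e n\<bar>"
    unfolding eventually_sequentially by auto
  with N0[of "max N0 N2"] have "\<exists>i. 1 \<le> i \<and> \<bar>e i\<bar> < \<bar>e n\<bar>"
    by (metis max.cobounded1 max.cobounded2 order.strict_trans)
  then obtain m where m: "1 \<le> m" "\<bar>e m\<bar> < \<bar>e n\<bar>"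
    and least: "\<And>i. 1 \<le> i \<Longrightarrow> i < m \<Longrightarrow> \<bar>e n\<bar> \<le> \<bar>e i\<bar>"
    using exists_least_iff[of "\<lambda>i. 1 \<le> i \<and> \<bar>e i\<bar> < \<bar>e n\<bar>"] by (metis not_less)
  have "N < m"
    using n(2)[of m] m by (meson atLeastAtMost_iff not_less)
  obtain M where M: "m = Suc M" "N \<le> M"
    using \<open>N < m\<close> by (cases m) auto
  obtain i where i: "1 \<le> i" "i \<le> M" "\<bar>e i\<bar> < \<beta> powr (- r * real M)"
    using N0[of M] M by (auto simp: N_def)
  have "\<bar>e n\<bar> < \<beta> powr (- r * real M)"
    using least[of i] i M by simp
  hence "\<beta> ^ m * \<bar>e n\<bar> < \<beta> ^ m * \<beta> powr (- r * real M)"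
    using \<beta> by simp
  \<comment> \<open>The summand 1 in the exponent is the shift from \<open>M\<close> to
    \<open>m = Suc M\<close>.\<close>
  also have "\<dots> = \<beta> powr (1 + (1 - r) * real M)"
  proof -
    have "\<beta> ^ m = \<beta> powr (1 + real M)"
      using \<beta> powr_realpow[of \<beta> m] by (simp add: M)
    thus ?thesis by (simp add: algebra_simps flip: powr_add)
  qed
  also have "\<dots> < \<eta>"
    using N1[of M] M by (simp add: N_def)
  finally have "\<beta> ^ m * \<bar>e n\<bar> < \<eta>" .
  moreover have "n < m"
    using n(1) \<open>N < m\<close> by simp
  ultimately show False
    using no_close_record_returns[OF \<beta> x _ _ _ \<eta>(2,3)] m
    unfolding e_def by blast
qed

theorem theorem1p2:
  fixes \<beta> x :: real
  assumes "\<beta> > 1"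
    and "x \<in> {0..<1}"
    and "\<not> purely_periodic_expansion \<beta> x"
  shows "uniform_recurrence_exponent \<beta> x \<le> 1"
  unfolding uniform_recurrence_exponent_def
  using exponent_le_one[OF assms] by (intro Sup_least) (auto simp: one_ereal_def)

end
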